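(* Let $\alpha$ be a non-degenerate null curve, defined on an open interval, in the 3-dimensional Minkowski spacetime $\mathbb E^3_1$, all three of whose coordinate functions $x,y,z$ have nowhere vanishing derivative. Then $\alpha$ can be parametrized in the form $$\alpha(s)=\alpha(s_0)+\frac{\varepsilon}{2}\int_{s_0}^{s}\frac{1}{f'(t)}\left(2f(t),\,f^2(t)-1,\,f^2(t)+1\right)dt,\qquad s,s_0\in I,$$ where $s$ is a pseudo-arc parameter, $I$ is a certain open interval, $\varepsilon\in\{1,-1\}$ is a constant, and $f\colon I\to\mathbb R$ is a nowhere vanishing function with nowhere vanishing derivative $f'$ on $I$. The torsion $\tau$ of such a curve is equal to the Schwarzian derivative $S(f)$ of the function $f$, that is, $$\tau=S(f)=\left(\frac{f''}{f'}\right)'-\frac12\left(\frac{f''}{f'}\right)^2 .$$ The vector fields $\mathbf L,\mathbf N,\mathbf W$ forming the Frenet frame of $\alpha$ are given by $$\mathbf L=\frac{\varepsilon}{2f'}\left(2f,f^2-1,f^2+1\right),$$ $$\mathbf W=-\frac{\varepsilon f''}{2f'^{\,2}}\left(2f,f^2-1,f^2+1\right)+\varepsilon\,(1,f,f),$$ $$\mathbf N=-\frac{\varepsilon f''^{\,2}}{4f'^{\,3}}\left(2f,f^2-1,f^2+1\right)+\frac{\varepsilon f''}{f'}(1,f,f)-\varepsilon f'(0,1,1).$$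
   Context: $\mathbb E^3_1$ denotes $\mathbb R^3$ with Cartesian coordinates $(x,y,z)$ and the Minkowski metric $g=dx^2+dy^2-dz^2$. All curves and functions are smooth. A curve $\alpha=(x,y,z)\colon I\to\mathbb E^3_1$ ($I$ an open interval) is null if $g(\alpha',\alpha')=0$ on $I$; it is non-degenerate if $\alpha',\alpha'',\alpha'''$ are linearly independent at every point. For a non-degenerate null curve $g(\alpha'',\alpha'')>0$; a parameter $s$ is called a pseudo-arc parameter if $g(\alpha'',\alpha'')=1$ (derivatives with respect to $s$). Such a parameter always exists and is unique up to changes $s\mapsto\pm s+\mathrm{const}$. For a null curve parametrized by a pseudo-arc parameter, the torsion is the function $$\tau=\tfrac12\, g(\alpha''',\alpha'''),$$ and the Frenet frame is the triple of vector fields $(\mathbf L,\mathbf N,\mathbf W)$ along $\alpha$ defined by $$\mathbf L=\alpha',\qquad \mathbf W=\alpha'',\qquad \mathbf N=-\alpha'''-\tfrac12 g(\alpha''',\alpha''')\,\alpha'.$$ *)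

theory Defs
  imports "HOL-Analysis.Analysis"
begin

definition minkowski :: "real^3 \<Rightarrow> real^3 \<Rightarrow> real" where
  "minkowski u v = u$1 * v$1 + u$2 * v$2 - u$3 * v$3"

definition open_interval :: "real set \<Rightarrow> bool" where
  "open_interval I \<longleftrightarrow> open I \<and> is_interval I \<and> I \<noteq> {}"

(* Curves and functions are total; only their values on an open interval matter. There the
   two-sided derivatives below depend on nothing else. *)
definition nderiv :: "nat \<Rightarrow> (real \<Rightarrow> 'a::real_normed_vector) \<Rightarrow> real \<Rightarrow> 'a" where
  "nderiv n \<gamma> = ((\<lambda>\<beta> t. vector_derivative \<beta> (at t)) ^^ n) \<gamma>"

definition smooth_on :: "real set \<Rightarrow> (real \<Rightarrow> 'a::real_normed_vector) \<Rightarrow> bool" where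
  "smooth_on I \<gamma> \<longleftrightarrow> (\<forall>n. \<forall>t\<in>I. nderiv n \<gamma> differentiable (at t))"

definition null_curve :: "(real \<Rightarrow> real^3) \<Rightarrow> real set \<Rightarrow> bool" where
  "null_curve \<alpha> I \<longleftrightarrow>
     smooth_on I \<alpha> \<and> (\<forall>t\<in>I. minkowski (nderiv 1 \<alpha> t) (nderiv 1 \<alpha> t) = 0)"

(* Distinctness is needed because independent speaks of the set, not of the triple. *)
definition nondegenerate :: "(real \<Rightarrow> real^3) \<Rightarrow> real set \<Rightarrow> bool" where
  "nondegenerate \<alpha> I \<longleftrightarrow>
     (\<forall>t\<in>I. distinct [nderiv 1 \<alpha> t, nderiv 2 \<alpha> t, nderiv 3 \<alpha> t] \<and>
            independent {nderiv 1 \<alpha> t, nderiv 2 \<alpha> t, nderiv 3 \<alpha> t})"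

definition pseudo_arc_parametrized :: "(real \<Rightarrow> real^3) \<Rightarrow> real set \<Rightarrow> bool" where
  "pseudo_arc_parametrized \<beta> I \<longleftrightarrow>
     (\<forall>s\<in>I. minkowski (nderiv 2 \<beta> s) (nderiv 2 \<beta> s) = 1)"

definition torsion :: "(real \<Rightarrow> real^3) \<Rightarrow> real \<Rightarrow> real" where
  "torsion \<beta> s = 1/2 * minkowski (nderiv 3 \<beta> s) (nderiv 3 \<beta> s)"

definition frenet_L :: "(real \<Rightarrow> real^3) \<Rightarrow> real \<Rightarrow> real^3" where
  "frenet_L \<beta> s = nderiv 1 \<beta> s"

definition frenet_W :: "(real \<Rightarrow> real^3) \<Rightarrow> real \<Rightarrow> real^3" where
  "frenet_W \<beta> s = nderiv 2 \<beta> s"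

definition frenet_N :: "(real \<Rightarrow> real^3) \<Rightarrow> real \<Rightarrow> real^3" where
  "frenet_N \<beta> s =
     - nderiv 3 \<beta> s - (1/2 * minkowski (nderiv 3 \<beta> s) (nderiv 3 \<beta> s)) *\<^sub>R nderiv 1 \<beta> s"

definition schwarzian :: "(real \<Rightarrow> real) \<Rightarrow> real \<Rightarrow> real" where
  "schwarzian f s =
     deriv (\<lambda>t. deriv (deriv f) t / deriv f t) s - 1/2 * (deriv (deriv f) s / deriv f s)\<^sup>2"

(* A smooth bijection with nowhere vanishing derivative; either orientation is allowed. *)
definition reparametrization :: "(real \<Rightarrow> real) \<Rightarrow> real set \<Rightarrow> real set \<Rightarrow> bool" where
  "reparametrization \<phi> I J \<longleftrightarrow>
     bij_betw \<phi> I J \<and> smooth_on I \<phi> \<and> (\<forall>s\<in>I. deriv \<phi> s \<noteq> 0)"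

(* The reparametrized curve \<alpha> \<circ> \<phi> has the integral form given by f and \<epsilon>.
   LBINT is the oriented integral, so s < s0 is covered. *)
definition null_representation ::
  "(real \<Rightarrow> real^3) \<Rightarrow> real set \<Rightarrow> (real \<Rightarrow> real) \<Rightarrow> real set \<Rightarrow> real \<Rightarrow> (real \<Rightarrow> real) \<Rightarrow> bool" where
  "null_representation \<alpha> J \<phi> I \<epsilon> f \<longleftrightarrow>
     open_interval I \<and> reparametrization \<phi> I J \<and> pseudo_arc_parametrized (\<alpha> \<circ> \<phi>) I \<and>
     \<epsilon> \<in> {1, -1} \<and> smooth_on I f \<and> (\<forall>s\<in>I. f s \<noteq> 0 \<and> deriv f s \<noteq> 0) \<and>
     (\<forall>s\<in>I. \<forall>s0\<in>I. (\<alpha> \<circ> \<phi>) s = (\<alpha> \<circ> \<phi>) s0 +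
        (\<epsilon>/2) *\<^sub>R (LBINT t=ereal s0..ereal s.
           (1 / deriv f t) *\<^sub>R (vector [2 * f t, (f t)\<^sup>2 - 1, (f t)\<^sup>2 + 1] :: real^3)))"

end

theory Submission
  imports Defs
begin

text \<open>Isotropic directions off a single line are parametrized by \<open>u \<mapsto> (2u, u\<^sup>2 - 1, u\<^sup>2 + 1)\<close>, so the
  tangent of a null curve is \<open>h (2F, F\<^sup>2 - 1, F\<^sup>2 + 1)\<close> with \<open>F = x' / (z' - y')\<close> and
  \<open>2h = z' - y'\<close>. Nondegeneracy gives \<open>F' \<noteq> 0\<close>, and \<open>g(\<alpha>'', \<alpha>'') = (2hF')\<^sup>2\<close>; a pseudo-arc
  parameter \<open>s\<close> is therefore an antiderivative of \<open>sqrt \<bar>2hF'\<bar>\<close>. In that parameter, with \<open>f\<close>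
  the function \<open>F\<close> expressed through \<open>s\<close> and \<open>\<epsilon>\<close> the sign of \<open>hF'\<close>, the factor \<open>h\<close> turns into
  \<open>\<epsilon> / (2f')\<close>. Torsion and Frenet frame come from differentiating this tangent twice more.\<close>

section \<open>Smooth functions on open sets\<close>

lemma nderiv_0 [simp]: "nderiv 0 f = f"
  by (simp add: nderiv_def)

lemma nderiv_Suc: "nderiv (Suc n) f = (\<lambda>t. vector_derivative (nderiv n f) (at t))"
  by (simp add: nderiv_def)

lemma nderiv_Suc_shift: "nderiv (Suc n) f = nderiv n (\<lambda>t. vector_derivative f (at t))"
  unfolding nderiv_def funpow_Suc_right by simp

lemma deriv_eq_vector_derivative: "deriv f t = vector_derivative f (at t)"
  for f :: "real \<Rightarrow> real"
  by (simp add: deriv_def vector_derivative_def has_real_derivative_iff_has_vector_derivative)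

text \<open>A derivative at \<open>t\<close> depends on a whole neighbourhood, so the induction
  carries equality at every point of \<open>S\<close>; openness of \<open>S\<close> turns this into
  equality near \<open>t\<close>.\<close>

lemma nderiv_cong:
  assumes "open S" and "\<And>t. t \<in> S \<Longrightarrow> f t = g t" and "t \<in> S"
  shows "nderiv n f t = nderiv n g t"
  using assms(3)
proof (induction n arbitrary: t)
  case 0
  then show ?case
    using assms by simp
next
  case (Suc n)
  have "eventually (\<lambda>u. u \<in> S) (nhds t)"
    using assms(1) Suc.prems by (rule eventually_nhds_in_open)
  then have "eventually (\<lambda>u. nderiv n f u = nderiv n g u) (nhds t)"
    by (rule eventually_mono) (rule Suc.IH)
  then show ?case
    unfolding nderiv_Suc by (intro vector_derivative_cong_eq) (auto simp: eventually_nhds)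
qed

section \<open>Differentiability of finite order\<close>

text \<open>Closure properties of smooth functions are proved by induction on the order, which
  \<open>smooth_on\<close> does not expose. The bound \<open>k<n\<close> is strict: order
  \<open>n\<close> means that the derivatives up to the \<open>n\<close>-th exist on
  \<open>S\<close>, and order \<open>0\<close> says nothing.\<close>

definition times_differentiable_on ::
  "nat \<Rightarrow> real set \<Rightarrow> (real \<Rightarrow> 'a::real_normed_vector) \<Rightarrow> bool" where
  "times_differentiable_on n S f \<longleftrightarrow> (\<forall>k<n. \<forall>t\<in>S. nderiv k f differentiable (at t))"

lemma smooth_on_iff: "smooth_on S f \<longleftrightarrow> (\<forall>n. times_differentiable_on n S f)"
  unfolding smooth_on_def times_differentiable_on_def by blast

lemma times_differentiable_on_0 [simp]: "times_differentiable_on 0 S f"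
  by (simp add: times_differentiable_on_def)

lemma times_differentiable_on_Suc:
  "times_differentiable_on (Suc n) S f \<longleftrightarrow>
    (\<forall>t\<in>S. f differentiable (at t)) \<and>
    times_differentiable_on n S (\<lambda>t. vector_derivative f (at t))"
  unfolding times_differentiable_on_def
  by (simp add: All_less_Suc2 nderiv_Suc_shift)

lemma times_differentiable_on_mono:
  "times_differentiable_on n S f \<Longrightarrow> m \<le> n \<Longrightarrow> times_differentiable_on m S f"
  by (simp add: times_differentiable_on_def)

lemma times_differentiable_on_cong:
  assumes "open S" and "\<And>t. t \<in> S \<Longrightarrow> f t = g t"
    and "times_differentiable_on n S f"
  shows "times_differentiable_on n S g"
  unfolding times_differentiable_on_def
proof (intro allI impI ballI)
  fix k t
  assume "k < n" "t \<in> S"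
  then have "(nderiv k f has_vector_derivative vector_derivative (nderiv k f) (at t)) (at t)"
    using assms(3) by (simp add: times_differentiable_on_def vector_derivative_works)
  then have "(nderiv k g has_vector_derivative vector_derivative (nderiv k f) (at t)) (at t)"
    using assms(1) \<open>t \<in> S\<close> nderiv_cong[OF assms(1,2)]
    by (rule has_vector_derivative_transform_within_open)
  then show "nderiv k g differentiable (at t)"
    by (rule differentiableI_vector)
qed

text \<open>The induction step of all closure proofs below. An explicit \<open>f'\<close> agrees
  with \<open>vector_derivative f\<close> on \<open>S\<close> only, which suffices since
  \<open>S\<close> is open.\<close>

lemma times_differentiable_on_SucI:
  assumes "open S"
    and deriv: "\<And>t. t \<in> S \<Longrightarrow> (f has_vector_derivative f' t) (at t)"
    and f': "times_differentiable_on n S f'"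
  shows "times_differentiable_on (Suc n) S f"
  unfolding times_differentiable_on_Suc
proof (intro conjI ballI)
  show "f differentiable (at t)" if "t \<in> S" for t
    using deriv[OF that] by (rule differentiableI_vector)
  show "times_differentiable_on n S (\<lambda>t. vector_derivative f (at t))"
    using \<open>open S\<close> _ f'
    by (rule times_differentiable_on_cong) (simp add: vector_derivative_at[OF deriv])
qed

lemma times_differentiable_on_SucD:
  assumes "times_differentiable_on (Suc n) S f"
  shows "t \<in> S \<Longrightarrow> (f has_vector_derivative vector_derivative f (at t)) (at t)"
    and "times_differentiable_on n S (\<lambda>t. vector_derivative f (at t))"
    and "times_differentiable_on n S f"
  using assms times_differentiable_on_mono[OF assms, of n]
  by (simp_all add: times_differentiable_on_Suc vector_derivative_works)

lemma times_differentiable_on_const: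
  assumes "open S"
  shows "times_differentiable_on n S (\<lambda>t. c)"
proof (induction n arbitrary: c)
  case (Suc n)
  show ?case
    using \<open>open S\<close> _ Suc by (rule times_differentiable_on_SucI) (rule has_vector_derivative_const)
qed simp

lemma times_differentiable_on_add:
  assumes "open S"
  shows "times_differentiable_on n S f \<Longrightarrow> times_differentiable_on n S g \<Longrightarrow>
    times_differentiable_on n S (\<lambda>t. f t + g t)"
proof (induction n arbitrary: f g)
  case (Suc n)
  note f = times_differentiable_on_SucD[OF Suc.prems(1)]
  note g = times_differentiable_on_SucD[OF Suc.prems(2)]
  show ?case
    using \<open>open S\<close> has_vector_derivative_add[OF f(1) g(1)] Suc.IH[OF f(2) g(2)]
    by (rule times_differentiable_on_SucI)
qed simp

lemma times_differentiable_on_bounded_linear: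
  assumes "open S" and "bounded_linear L"
  shows "times_differentiable_on n S f \<Longrightarrow> times_differentiable_on n S (\<lambda>t. L (f t))"
proof (induction n arbitrary: f)
  case (Suc n)
  note f = times_differentiable_on_SucD[OF Suc.prems]
  show ?case
    using \<open>open S\<close> bounded_linear.has_vector_derivative[OF assms(2) f(1)] Suc.IH[OF f(2)]
    by (rule times_differentiable_on_SucI)
qed simp

text \<open>By the Leibniz rule the derivative is a sum of products of functions of order
  \<open>n\<close>. The induction hypothesis must therefore range over all pairs of factors.\<close>

lemma times_differentiable_on_mult:
  fixes f g :: "real \<Rightarrow> real"
  assumes "open S"
  shows "times_differentiable_on n S f \<Longrightarrow> times_differentiable_on n S g \<Longrightarrow>
    times_differentiable_on n S (\<lambda>t. f t * g t)"
proof (induction n arbitrary: f g)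
  case (Suc n)
  note f = times_differentiable_on_SucD[OF Suc.prems(1)]
  note g = times_differentiable_on_SucD[OF Suc.prems(2)]
  show ?case
    using \<open>open S\<close> has_vector_derivative_mult[OF f(1) g(1)]
      times_differentiable_on_add[OF \<open>open S\<close> Suc.IH[OF f(3) g(2)] Suc.IH[OF f(2) g(3)]]
    by (rule times_differentiable_on_SucI)
qed simp

text \<open>The derivative is a product of \<open>f'\<close> and copies of
  \<open>inverse (f t)\<close> itself, whose order \<open>n\<close> is the induction hypothesis;
  each round gains one order.\<close>

lemma times_differentiable_on_inverse:
  fixes f :: "real \<Rightarrow> real"
  assumes "open S" and "\<forall>t\<in>S. f t \<noteq> 0"
  shows "times_differentiable_on n S f \<Longrightarrow> times_differentiable_on n S (\<lambda>t. inverse (f t))"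
proof (induction n)
  case (Suc n)
  note f = times_differentiable_on_SucD[OF Suc.prems]
  \<comment> \<open>The sign is written as the factor \<open>- 1\<close> so that closure under
    constants and products covers the whole expression.\<close>
  have "((\<lambda>t. inverse (f t)) has_vector_derivative
      - 1 * (inverse (f t) * (vector_derivative f (at t) * inverse (f t)))) (at t)"
    if "t \<in> S" for t
    using DERIV_inverse'[of f "vector_derivative f (at t)" t UNIV] f(1)[OF that]
      bspec[OF assms(2) that]
    by (simp add: has_real_derivative_iff_has_vector_derivative mult.assoc)
  moreover have "times_differentiable_on n S (\<lambda>t.
      - 1 * (inverse (f t) * (vector_derivative f (at t) * inverse (f t))))"
    using \<open>open S\<close> f(2) Suc.IH[OF f(3)]
    by (intro times_differentiable_on_mult times_differentiable_on_const)
  ultimately show ?case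
    by (rule times_differentiable_on_SucI[OF \<open>open S\<close>])
qed simp

lemma times_differentiable_on_sqrt:
  assumes "open S" and "\<forall>t\<in>S. f t > 0"
  shows "times_differentiable_on n S f \<Longrightarrow> times_differentiable_on n S (\<lambda>t. sqrt (f t))"
proof (induction n)
  case (Suc n)
  note f = times_differentiable_on_SucD[OF Suc.prems]
  have "((\<lambda>t. sqrt (f t)) has_vector_derivative
      1 / 2 * inverse (sqrt (f t)) * vector_derivative f (at t)) (at t)"
    if "t \<in> S" for t
    using DERIV_real_sqrt[THEN DERIV_chain2, of f t "vector_derivative f (at t)"]
      f(1)[OF that] bspec[OF assms(2) that]
    by (simp add: has_real_derivative_iff_has_vector_derivative field_simps)
  moreover have "\<forall>t\<in>S. sqrt (f t) \<noteq> 0"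
    using assms(2) by force
  then have "times_differentiable_on n S (\<lambda>t.
      1 / 2 * inverse (sqrt (f t)) * vector_derivative f (at t))"
    using \<open>open S\<close> f(2) Suc.IH[OF f(3)]
    by (intro times_differentiable_on_mult times_differentiable_on_const
        times_differentiable_on_inverse)
  ultimately show ?case
    by (rule times_differentiable_on_SucI[OF \<open>open S\<close>])
qed simp

lemma times_differentiable_on_compose:
  fixes f \<phi> :: "real \<Rightarrow> real"
  assumes "open I" and "\<phi> ` I \<subseteq> J"
  shows "times_differentiable_on n J f \<Longrightarrow> times_differentiable_on n I \<phi> \<Longrightarrow>
    times_differentiable_on n I (\<lambda>s. f (\<phi> s))"
proof (induction n arbitrary: f)
  case (Suc n)
  note f = times_differentiable_on_SucD[OF Suc.prems(1)]
  note \<phi> = times_differentiable_on_SucD[OF Suc.prems(2)]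
  have "((\<lambda>s. f (\<phi> s)) has_vector_derivative
      vector_derivative \<phi> (at s) * vector_derivative f (at (\<phi> s))) (at s)"
    if "s \<in> I" for s
    using vector_diff_chain_at[OF \<phi>(1) f(1), of s] that assms(2)
    by (auto simp: o_def)
  then show ?case
    using \<open>open I\<close> times_differentiable_on_mult[OF \<open>open I\<close> \<phi>(2) Suc.IH[OF f(2) \<phi>(3)]]
    by (intro times_differentiable_on_SucI)
qed simp

section \<open>Inverse functions\<close>

lemma has_vector_derivative_inverse_function:
  fixes \<psi> \<phi> p :: "real \<Rightarrow> real"
  assumes "open J" and "t \<in> J"
    and deriv: "\<And>t. t \<in> J \<Longrightarrow> (\<psi> has_vector_derivative p t) (at t)"
    and "p t \<noteq> 0" and inv: "\<And>t. t \<in> J \<Longrightarrow> \<phi> (\<psi> t) = t"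
  shows "(\<phi> has_vector_derivative inverse (p t)) (at (\<psi> t))"
proof -
  have "continuous_on J \<psi>"
    using deriv has_vector_derivative_continuous
    by (intro continuous_at_imp_continuous_on) blast
  moreover have "(\<psi> has_derivative (\<lambda>h. h *\<^sub>R p t)) (at t)"
    using deriv[OF \<open>t \<in> J\<close>] by (simp add: has_vector_derivative_def)
  moreover have "(\<lambda>h. h *\<^sub>R p t) \<circ> (\<lambda>h. h *\<^sub>R inverse (p t)) = id"
    using \<open>p t \<noteq> 0\<close> by (auto simp: fun_eq_iff)
  ultimately show ?thesis
    unfolding has_vector_derivative_def
    using assms(1,2) inv by (intro has_derivative_inverse_strong[of J t \<psi> \<phi>])
qed

text \<open>Bootstrapping in the differential equation for \<open>\<phi>\<close>: if
  \<open>\<phi>\<close> has order \<open>n\<close>, so has its derivative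
  \<open>inverse (p (\<phi> s))\<close>, hence \<open>\<phi>\<close> has order
  \<open>n + 1\<close>.\<close>

lemma smooth_on_inverse_function:
  fixes \<psi> \<phi> p :: "real \<Rightarrow> real"
  assumes "open J" and "open I" and "\<phi> ` I \<subseteq> J"
    and "smooth_on J p" and "\<And>t. t \<in> J \<Longrightarrow> p t \<noteq> 0"
    and deriv: "\<And>s. s \<in> I \<Longrightarrow> (\<phi> has_vector_derivative inverse (p (\<phi> s))) (at s)"
  shows "smooth_on I \<phi>"
  unfolding smooth_on_iff
proof
  fix n
  show "times_differentiable_on n I \<phi>"
  proof (induction n)
    case (Suc n)
    have "times_differentiable_on n J (\<lambda>t. inverse (p t))"
      using assms by (intro times_differentiable_on_inverse) (auto simp: smooth_on_iff)
    from times_differentiable_on_compose[OF \<open>open I\<close> assms(3) this Suc]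
    show ?case
      using \<open>open I\<close> deriv by (intro times_differentiable_on_SucI)
  qed simp
qed

section \<open>Smooth functions of all orders\<close>

lemma smooth_on_has_vector_derivative:
  assumes "smooth_on S f" and "t \<in> S"
  shows "(f has_vector_derivative vector_derivative f (at t)) (at t)"
proof -
  have "nderiv 0 f differentiable (at t)"
    using assms unfolding smooth_on_def by blast
  then show ?thesis
    by (simp add: vector_derivative_works)
qed

lemma smooth_on_vector_derivative:
  "smooth_on S f \<Longrightarrow> smooth_on S (\<lambda>t. vector_derivative f (at t))"
  unfolding smooth_on_def nderiv_Suc_shift[symmetric] by blast

lemma smooth_on_isCont: "smooth_on S f \<Longrightarrow> t \<in> S \<Longrightarrow> isCont f t"
  by (rule has_vector_derivative_continuous[OF smooth_on_has_vector_derivative])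

lemma smooth_on_DERIV:
  fixes f :: "real \<Rightarrow> real"
  assumes "smooth_on S f" and "t \<in> S"
  shows "(f has_real_derivative deriv f t) (at t)"
  using smooth_on_has_vector_derivative[OF assms]
  by (simp add: has_real_derivative_iff_has_vector_derivative deriv_eq_vector_derivative)

lemma smooth_on_deriv: "smooth_on S f \<Longrightarrow> smooth_on S (deriv f)"
  for f :: "real \<Rightarrow> real"
  using smooth_on_vector_derivative[of S f] by (simp add: deriv_eq_vector_derivative[abs_def])

lemma smooth_on_const: "open S \<Longrightarrow> smooth_on S (\<lambda>t. c)"
  by (simp add: smooth_on_iff times_differentiable_on_const)

lemma smooth_on_bounded_linear:
  "open S \<Longrightarrow> bounded_linear L \<Longrightarrow> smooth_on S f \<Longrightarrow> smooth_on S (\<lambda>t. L (f t))"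
  by (simp add: smooth_on_iff times_differentiable_on_bounded_linear)

lemma smooth_on_mult:
  fixes f g :: "real \<Rightarrow> real"
  shows "open S \<Longrightarrow> smooth_on S f \<Longrightarrow> smooth_on S g \<Longrightarrow> smooth_on S (\<lambda>t. f t * g t)"
  by (simp add: smooth_on_iff times_differentiable_on_mult)

lemma smooth_on_inverse:
  fixes f :: "real \<Rightarrow> real"
  shows "open S \<Longrightarrow> \<forall>t\<in>S. f t \<noteq> 0 \<Longrightarrow> smooth_on S f \<Longrightarrow> smooth_on S (\<lambda>t. inverse (f t))"
  by (simp add: smooth_on_iff times_differentiable_on_inverse)

lemma smooth_on_sqrt:
  "open S \<Longrightarrow> \<forall>t\<in>S. f t > 0 \<Longrightarrow> smooth_on S f \<Longrightarrow> smooth_on S (\<lambda>t. sqrt (f t))"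
  by (simp add: smooth_on_iff times_differentiable_on_sqrt)

lemma smooth_on_compose:
  fixes f \<phi> :: "real \<Rightarrow> real"
  shows "open I \<Longrightarrow> \<phi> ` I \<subseteq> J \<Longrightarrow> smooth_on J f \<Longrightarrow> smooth_on I \<phi> \<Longrightarrow>
    smooth_on I (\<lambda>s. f (\<phi> s))"
  by (simp add: smooth_on_iff times_differentiable_on_compose)

section \<open>Antiderivatives on open intervals\<close>

text \<open>Connects open intervals with the form in which \<open>einterval_antiderivative\<close>
  speaks of them. Infimum and supremum are taken in \<open>ereal\<close>, so unbounded intervals are
  included.\<close>

lemma open_interval_eq_einterval:
  assumes "open_interval J"
  obtains a b where "a < b" and "J = einterval a b"
proof
  let ?a = "Inf (ereal ` J)" and ?b = "Sup (ereal ` J)"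
  have J: "open J" "is_interval J" "J \<noteq> {}"
    using assms by (auto simp: open_interval_def)
  have inside: "?a < ereal x \<and> ereal x < ?b" if x: "x \<in> J" for x
  proof -
    \<comment> \<open>Openness leaves room on both sides of \<open>x\<close>, which makes the bounds
      strict.\<close>
    obtain e where "e > 0" "ball x e \<subseteq> J"
      using J(1) x open_contains_ball by blast
    then have "x - e / 2 \<in> J" "x + e / 2 \<in> J"
      by (auto simp: subset_iff dist_real_def)
    then have "?a \<le> ereal (x - e / 2)" "ereal (x + e / 2) \<le> ?b"
      by (auto intro: Inf_lower Sup_upper)
    moreover have "ereal (x - e / 2) < ereal x" "ereal x < ereal (x + e / 2)"
      using \<open>e > 0\<close> by simp_all
    ultimately show ?thesis
      by (meson le_less_trans less_le_trans)
  qed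
  then show "?a < ?b"
    using J(3) by (meson ex_in_conv less_trans)
  show "J = einterval ?a ?b"
  proof (rule set_eqI, unfold einterval_iff, rule iffI)
    fix x
    assume "?a < ereal x \<and> ereal x < ?b"
    then obtain u v where "u \<in> J" "v \<in> J" "u < x" "x < v"
      by (auto simp: Inf_less_iff less_Sup_iff)
    then show "x \<in> J"
      using J(2) by (meson less_imp_le mem_is_interval_1_I)
  qed (rule inside)
qed

lemma open_interval_antiderivative:
  fixes f :: "real \<Rightarrow> 'a::euclidean_space"
  assumes "open_interval J" and "\<forall>t\<in>J. isCont f t"
  obtains F where "\<forall>t\<in>J. (F has_vector_derivative f t) (at t)"
proof -
  obtain a b where "a < b" "J = einterval a b"
    using assms(1) by (rule open_interval_eq_einterval)
  with assms(2) obtain F where "\<And>t. a < ereal t \<Longrightarrow> ereal t < b \<Longrightarrow> (F has_vector_derivative f t) (at t)"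
    using einterval_antiderivative[of a b f] by (metis einterval_iff)
  with \<open>J = einterval a b\<close> show ?thesis
    by (intro that[of F]) (simp add: einterval_iff)
qed

lemma LBINT_eq_diff:
  fixes f F :: "real \<Rightarrow> 'a::euclidean_space"
  assumes "open_interval J" and "a \<in> J" and "b \<in> J"
    and "\<forall>t\<in>J. isCont f t"
    and "\<forall>t\<in>J. (F has_vector_derivative f t) (at t)"
  shows "(LBINT t=a..b. f t) = F b - F a"
proof (rule interval_integral_FTC_finite)
  \<comment> \<open>The oriented integral allows \<open>b < a\<close>, so the segment is described
    by \<open>min\<close> and \<open>max\<close>.\<close>
  have sub: "{min a b..max a b} \<subseteq> J"
    using assms(1-3) mem_is_interval_1_I[of J "min a b" "max a b"]
    by (auto simp: open_interval_def min_def max_def split: if_splits)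
  then show "continuous_on {min a b..max a b} f"
    using assms(4) by (intro continuous_at_imp_continuous_on) auto
  show "(F has_vector_derivative f t) (at t within {min a b..max a b})"
    if "min a b \<le> t" "t \<le> max a b" for t
    using that sub assms(5) has_vector_derivative_at_within by fastforce
qed

text \<open>Solves \<open>ds/dt = p\<close> for a new parameter \<open>s\<close>. An antiderivative
  \<open>\<psi>\<close> of the positive function \<open>p\<close> is strictly increasing, hence
  injective; \<open>I\<close> is its image and \<open>\<phi>\<close> its inverse.\<close>

lemma inverse_antiderivative:
  fixes p :: "real \<Rightarrow> real"
  assumes "open_interval J" and "smooth_on J p" and "\<forall>t\<in>J. p t > 0"
  obtains \<phi> I where "open_interval I" and "reparametrization \<phi> I J"
    and "\<forall>s\<in>I. (\<phi> has_vector_derivative inverse (p (\<phi> s))) (at s)"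
proof -
  have J: "open J" "is_interval J" "J \<noteq> {}"
    using assms(1) by (auto simp: open_interval_def)
  have "\<forall>t\<in>J. isCont p t"
    using smooth_on_isCont[OF assms(2)] by blast
  then obtain \<psi> where \<psi>: "\<forall>t\<in>J. (\<psi> has_vector_derivative p t) (at t)"
    by (rule open_interval_antiderivative[OF assms(1)])
  then have cont: "continuous_on J \<psi>"
    by (intro continuous_at_imp_continuous_on) (auto intro: has_vector_derivative_continuous)
  have less: "\<psi> a < \<psi> b" if "a \<in> J" "b \<in> J" "a < b" for a b
  proof (rule DERIV_pos_imp_increasing[OF \<open>a < b\<close>])
    fix t
    assume "a \<le> t" "t \<le> b"
    then have "t \<in> J"
      using mem_is_interval_1_I[OF J(2) that(1,2)] by blast
    then show "\<exists>y. (\<psi> has_real_derivative y) (at t) \<and> 0 < y"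
      using \<psi> assms(3) by (auto simp: has_real_derivative_iff_has_vector_derivative)
  qed
  then have inj: "inj_on \<psi> J"
    by (metis inj_onI less_irrefl linorder_neqE_linordered_idom)
  define I where "I = \<psi> ` J"
  define \<phi> where "\<phi> = inv_into J \<psi>"
  have inv: "\<phi> (\<psi> t) = t" if "t \<in> J" for t
    using inj that by (simp add: \<phi>_def)
  have img: "\<phi> ` I \<subseteq> J"
    by (auto simp: I_def inv)
  \<comment> \<open>An injective continuous real function on an open set maps open sets to open
    sets.\<close>
  have "open I"
    unfolding I_def using J(1) cont inj by (intro injective_into_1d_imp_open_map_UNIV[of J J]) auto
  moreover have "connected I"
    unfolding I_def using cont J(2) is_interval_connected by (intro connected_continuous_image)
  ultimately have I: "open_interval I"
    using J(3) by (auto simp: open_interval_def is_interval_connected_1 I_def)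
  have \<phi>': "(\<phi> has_vector_derivative inverse (p (\<phi> s))) (at s)" if "s \<in> I" for s
  proof -
    obtain t where t: "t \<in> J" "s = \<psi> t"
      using \<open>s \<in> I\<close> by (auto simp: I_def)
    show ?thesis
      unfolding t(2) inv[OF t(1)]
      using J(1) t(1) by (rule has_vector_derivative_inverse_function)
        (use \<psi> assms(3) t(1) inv in force)+
  qed
  have "smooth_on I \<phi>"
    by (rule smooth_on_inverse_function[OF J(1) \<open>open I\<close> img assms(2) _ \<phi>']) (use assms(3) in force)
  moreover have "bij_betw \<phi> I J"
    unfolding \<phi>_def I_def using inj by (intro bij_betw_inv_into inj_on_imp_bij_betw)
  moreover have "deriv \<phi> s \<noteq> 0" if "s \<in> I" for s
  proof -
    have "\<phi> s \<in> J"
      using img that by blast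
    then show ?thesis
      using vector_derivative_at[OF \<phi>'[OF that]] assms(3) by (force simp: deriv_eq_vector_derivative)
  qed
  ultimately have "reparametrization \<phi> I J"
    by (simp add: reparametrization_def)
  with I \<phi>' show ?thesis
    by (intro that) auto
qed

lemma nonzero_constant_sign:
  fixes q :: "real \<Rightarrow> real"
  assumes "open_interval J" and "\<forall>t\<in>J. isCont q t" and "\<forall>t\<in>J. q t \<noteq> 0"
  obtains \<epsilon> :: real where "\<epsilon> \<in> {1, -1}" and "\<forall>t\<in>J. \<epsilon> * q t > 0"
proof -
  have "connected J"
    using assms(1) by (auto simp: open_interval_def is_interval_connected)
  then have "connected (q ` J)"
    using assms(2) by (intro connected_continuous_image continuous_at_imp_continuous_on)
  then have "is_interval (q ` J)"
    by (simp add: is_interval_connected_1)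
  then have *: "0 \<in> q ` J" if "a \<in> J" "b \<in> J" "q a < 0" "q b > 0" for a b
    using that mem_is_interval_1_I[of "q ` J" "q a" "q b" 0] by simp
  show ?thesis
  proof (cases "\<exists>a\<in>J. q a < 0")
    case True
    then have "\<forall>t\<in>J. q t < 0"
      using * assms(3) by (metis imageE linorder_neqE_linordered_idom)
    then show ?thesis
      by (intro that[of "-1"]) auto
  next
    case False
    then show ?thesis
      using assms(3) by (intro that[of 1]) (auto simp: not_less le_less)
  qed
qed

section \<open>Curves with tangent on the isotropic cone\<close>

text \<open>\<open>cone_vec u\<close>, \<open>tangent_vec u\<close> and \<open>axis_vec\<close> are, up to constant factors, the successive
  derivatives of the parabola \<open>cone_vec\<close>; their Minkowski Gram matrix does not depend on \<open>u\<close>.\<close>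

definition cone_vec :: "real \<Rightarrow> real^3" where
  "cone_vec u = vector [2 * u, u\<^sup>2 - 1, u\<^sup>2 + 1]"

definition tangent_vec :: "real \<Rightarrow> real^3" where
  "tangent_vec u = vector [1, u, u]"

definition axis_vec :: "real^3" where
  "axis_vec = vector [0, 1, 1]"

text \<open>\<open>cone_vec u\<close> and \<open>axis_vec\<close> are isotropic with product
  \<open>-2\<close>, and \<open>tangent_vec u\<close> is a unit vector orthogonal to both. Only the
  squared \<open>tangent_vec\<close> coefficient and the mixed term survive.\<close>

lemma minkowski_cone_frame:
  "minkowski (a *\<^sub>R cone_vec u + b *\<^sub>R tangent_vec u + c *\<^sub>R axis_vec)
    (a *\<^sub>R cone_vec u + b *\<^sub>R tangent_vec u + c *\<^sub>R axis_vec) = b\<^sup>2 - 4 * a * c"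
  by (simp add: minkowski_def cone_vec_def tangent_vec_def axis_vec_def
      power2_eq_square algebra_simps)

text \<open>Isotropy reads \<open>x^2 = (z - y) (z + y)\<close>. Dividing by
  \<open>(z - y)^2\<close> expresses \<open>z + y\<close> through \<open>z - y\<close> and the ratio
  \<open>x / (z - y)\<close>.\<close>

lemma isotropic_eq_cone_vec:
  assumes "minkowski v v = 0" and "v $ 3 \<noteq> v $ 2"
  shows "v = ((v $ 3 - v $ 2) / 2) *\<^sub>R cone_vec (v $ 1 / (v $ 3 - v $ 2))"
proof -
  let ?k = "v $ 3 - v $ 2"
  have "(v $ 1)\<^sup>2 = ?k * (v $ 3 + v $ 2)"
    using assms(1) by (simp add: minkowski_def power2_eq_square algebra_simps)
  then have u: "(v $ 1 / ?k)\<^sup>2 = (v $ 3 + v $ 2) / ?k"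
    using assms(2) by (simp add: power_divide power2_eq_square)
  show ?thesis
    using assms(2) unfolding cone_vec_def vec_eq_iff forall_3 u by (simp add: field_simps)
qed

section \<open>Differentiating along the moving frame\<close>

lemma has_vector_derivative_vector_3:
  fixes f g h :: "real \<Rightarrow> real"
  assumes "(f has_real_derivative f') (at t)" and "(g has_real_derivative g') (at t)"
    and "(h has_real_derivative h') (at t)"
  shows "((\<lambda>t. vector [f t, g t, h t] :: real^3) has_vector_derivative vector [f', g', h']) (at t)"
proof -
  have vec: "(vector [a, b, c] :: real^3) = a *\<^sub>R axis 1 1 + b *\<^sub>R axis 2 1 + c *\<^sub>R axis 3 1"
    for a b c :: real
    by (simp add: vec_eq_iff forall_3 axis_def)
  note assms[unfolded has_real_derivative_iff_has_vector_derivative, derivative_intros]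
  show ?thesis
    unfolding vec
    by (auto intro!: derivative_eq_intros assms)
qed

lemma has_vector_derivative_cone_vec:
  assumes "(f has_real_derivative f') (at t)"
  shows "((\<lambda>t. cone_vec (f t)) has_vector_derivative (2 * f') *\<^sub>R tangent_vec (f t)) (at t)"
proof -
  have "((\<lambda>t. cone_vec (f t)) has_vector_derivative
      vector [2 * f', 2 * f t * f', 2 * f t * f']) (at t)"
    unfolding cone_vec_def
    by (intro has_vector_derivative_vector_3) (auto intro!: derivative_eq_intros assms)
  also have "vector [2 * f', 2 * f t * f', 2 * f t * f'] = (2 * f') *\<^sub>R tangent_vec (f t)"
    by (simp add: vec_eq_iff forall_3 tangent_vec_def)
  finally show ?thesis .
qed

lemma has_vector_derivative_tangent_vec:
  assumes "(f has_real_derivative f') (at t)"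
  shows "((\<lambda>t. tangent_vec (f t)) has_vector_derivative f' *\<^sub>R axis_vec) (at t)"
proof -
  have "((\<lambda>t. tangent_vec (f t)) has_vector_derivative vector [0, f', f']) (at t)"
    unfolding tangent_vec_def
    by (intro has_vector_derivative_vector_3) (auto intro!: derivative_eq_intros assms)
  also have "vector [0, f', f'] = f' *\<^sub>R axis_vec"
    by (simp add: vec_eq_iff forall_3 axis_vec_def)
  finally show ?thesis .
qed

text \<open>The factor \<open>2 f'\<close> from differentiating \<open>cone_vec (f s)\<close>
  cancels the denominator of the coefficient, leaving exactly \<open>\<epsilon>\<close> on
  \<open>tangent_vec (f s)\<close>. This is why the parameter is pseudo-arc.\<close>

lemma has_vector_derivative_tangent_field:
  fixes f :: "real \<Rightarrow> real"
  assumes "smooth_on I f" and "s \<in> I" and "deriv f s \<noteq> 0"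
  shows "((\<lambda>s. (\<epsilon> / (2 * deriv f s)) *\<^sub>R cone_vec (f s)) has_vector_derivative
    - (\<epsilon> * deriv (deriv f) s / (2 * (deriv f s)\<^sup>2)) *\<^sub>R cone_vec (f s)
      + \<epsilon> *\<^sub>R tangent_vec (f s)) (at s)"
proof -
  note f = smooth_on_DERIV[OF assms(1,2)] smooth_on_DERIV[OF smooth_on_deriv[OF assms(1)] assms(2)]
  have "((\<lambda>s. \<epsilon> / (2 * deriv f s)) has_real_derivative
      - (\<epsilon> * deriv (deriv f) s / (2 * (deriv f s)\<^sup>2))) (at s)"
    using assms(3)
    by (auto intro!: derivative_eq_intros f simp: field_simps power2_eq_square)
  from has_vector_derivative_scaleR[OF this has_vector_derivative_cone_vec[OF f(1)]]
  show ?thesis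
    using assms(3) by (simp add: add.commute)
qed

lemma has_vector_derivative_normal_field:
  fixes f :: "real \<Rightarrow> real"
  assumes "smooth_on I f" and "s \<in> I" and "deriv f s \<noteq> 0"
  shows "((\<lambda>s. - (\<epsilon> * deriv (deriv f) s / (2 * (deriv f s)\<^sup>2)) *\<^sub>R cone_vec (f s)
      + \<epsilon> *\<^sub>R tangent_vec (f s)) has_vector_derivative
    (\<epsilon> * ((deriv (deriv f) s)\<^sup>2 / (deriv f s)^3
          - deriv (deriv (deriv f)) s / (2 * (deriv f s)\<^sup>2))) *\<^sub>R cone_vec (f s)
      + (- (\<epsilon> * deriv (deriv f) s / deriv f s)) *\<^sub>R tangent_vec (f s)
      + (\<epsilon> * deriv f s) *\<^sub>R axis_vec) (at s)"
proof -
  note f = smooth_on_DERIV[OF assms(1,2)] smooth_on_DERIV[OF smooth_on_deriv[OF assms(1)] assms(2)]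
    smooth_on_DERIV[OF smooth_on_deriv[OF smooth_on_deriv[OF assms(1)]] assms(2)]
  have "((\<lambda>s. - (\<epsilon> * deriv (deriv f) s / (2 * (deriv f s)\<^sup>2))) has_real_derivative
      \<epsilon> * ((deriv (deriv f) s)\<^sup>2 / (deriv f s)^3
          - deriv (deriv (deriv f)) s / (2 * (deriv f s)\<^sup>2))) (at s)"
    using assms(3)
    by (auto intro!: derivative_eq_intros f simp: field_simps power2_eq_square power3_eq_cube)
  from has_vector_derivative_add[OF
      has_vector_derivative_scaleR[OF this has_vector_derivative_cone_vec[OF f(1)]]
      has_vector_derivative_scaleR[OF DERIV_const has_vector_derivative_tangent_vec[OF f(1)]]]
  show ?thesis
    using assms(3) by (simp add: algebra_simps power2_eq_square)
qed

lemma
  fixes f :: "real \<Rightarrow> real" and \<beta> :: "real \<Rightarrow> real^3"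
  assumes "open I" and "smooth_on I f" and "\<forall>s\<in>I. deriv f s \<noteq> 0"
    and \<beta>': "\<forall>s\<in>I.
      (\<beta> has_vector_derivative (\<epsilon> / (2 * deriv f s)) *\<^sub>R cone_vec (f s)) (at s)"
    and "s \<in> I"
  shows nderiv_1_cone: "nderiv 1 \<beta> s = (\<epsilon> / (2 * deriv f s)) *\<^sub>R cone_vec (f s)"
    and nderiv_2_cone: "nderiv 2 \<beta> s =
      - (\<epsilon> * deriv (deriv f) s / (2 * (deriv f s)\<^sup>2)) *\<^sub>R cone_vec (f s)
      + \<epsilon> *\<^sub>R tangent_vec (f s)"
    and nderiv_3_cone: "nderiv 3 \<beta> s =
      (\<epsilon> * ((deriv (deriv f) s)\<^sup>2 / (deriv f s)^3
          - deriv (deriv (deriv f)) s / (2 * (deriv f s)\<^sup>2))) *\<^sub>R cone_vec (f s)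
      + (- (\<epsilon> * deriv (deriv f) s / deriv f s)) *\<^sub>R tangent_vec (f s)
      + (\<epsilon> * deriv f s) *\<^sub>R axis_vec"
proof -
  \<comment> \<open>A formula for the \<open>n\<close>-th derivative valid throughout the open set
    \<open>I\<close> may be differentiated again.\<close>
  have step: "nderiv (Suc n) \<beta> s = D"
    if "\<And>s. s \<in> I \<Longrightarrow> nderiv n \<beta> s = g s" and "(g has_vector_derivative D) (at s)" and "s \<in> I"
    for n g D s
    unfolding nderiv_Suc
    using has_vector_derivative_transform_within_open[OF
        that(2) \<open>open I\<close> that(3) that(1)[symmetric]]
    by (rule vector_derivative_at)
  have 1: "nderiv (Suc 0) \<beta> s = (\<epsilon> / (2 * deriv f s)) *\<^sub>R cone_vec (f s)" if "s \<in> I" for s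
    using step[of 0 \<beta>, OF _ bspec[OF \<beta>' that] that] by simp
  have 2: "nderiv (Suc (Suc 0)) \<beta> s =
      - (\<epsilon> * deriv (deriv f) s / (2 * (deriv f s)\<^sup>2)) *\<^sub>R cone_vec (f s)
      + \<epsilon> *\<^sub>R tangent_vec (f s)" if "s \<in> I" for s
    using step[OF 1 has_vector_derivative_tangent_field[OF assms(2) that bspec[OF assms(3) that]] that] .
  note 3 = step[OF 2 has_vector_derivative_normal_field[OF assms(2,5) bspec[OF assms(3,5)]] assms(5)]
  show "nderiv 1 \<beta> s = (\<epsilon> / (2 * deriv f s)) *\<^sub>R cone_vec (f s)"
    using 1 \<open>s \<in> I\<close> by simp
  show "nderiv 2 \<beta> s = - (\<epsilon> * deriv (deriv f) s / (2 * (deriv f s)\<^sup>2)) *\<^sub>R cone_vec (f s)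
      + \<epsilon> *\<^sub>R tangent_vec (f s)"
    using 2 \<open>s \<in> I\<close> by (simp add: numeral_2_eq_2)
  show "nderiv 3 \<beta> s =
      (\<epsilon> * ((deriv (deriv f) s)\<^sup>2 / (deriv f s)^3
          - deriv (deriv (deriv f)) s / (2 * (deriv f s)\<^sup>2))) *\<^sub>R cone_vec (f s)
      + (- (\<epsilon> * deriv (deriv f) s / deriv f s)) *\<^sub>R tangent_vec (f s)
      + (\<epsilon> * deriv f s) *\<^sub>R axis_vec"
    using 3 by (simp add: eval_nat_numeral)
qed

section \<open>Torsion and Frenet frame in terms of \<open>f\<close>\<close>

lemma schwarzian_eq:
  assumes "smooth_on I f" and "s \<in> I" and "deriv f s \<noteq> 0"
  shows "schwarzian f s =
    deriv (deriv (deriv f)) s / deriv f s - 3 / 2 * (deriv (deriv f) s / deriv f s)\<^sup>2"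
proof -
  note f = smooth_on_DERIV[OF smooth_on_deriv[OF assms(1)] assms(2)]
    smooth_on_DERIV[OF smooth_on_deriv[OF smooth_on_deriv[OF assms(1)]] assms(2)]
  have "((\<lambda>t. deriv (deriv f) t / deriv f t) has_real_derivative
      deriv (deriv (deriv f)) s / deriv f s - (deriv (deriv f) s / deriv f s)\<^sup>2) (at s)"
    using assms(3)
    by (auto intro!: derivative_eq_intros f simp: field_simps power2_eq_square)
  then show ?thesis
    unfolding schwarzian_def by (simp add: DERIV_imp_deriv)
qed

text \<open>The torsion is half the Gram form of the third derivative, and
  \<open>\<epsilon> * \<epsilon> = 1\<close> removes the sign. The quotient rule in
  \<open>schwarzian_eq\<close> brings the Schwarzian to the same expression.\<close>

lemma frenet_frame_cone:
  fixes f :: "real \<Rightarrow> real" and \<beta> :: "real \<Rightarrow> real^3"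
  assumes "open I" and "smooth_on I f" and "\<forall>s\<in>I. deriv f s \<noteq> 0"
    and "\<forall>s\<in>I.
      (\<beta> has_vector_derivative (\<epsilon> / (2 * deriv f s)) *\<^sub>R cone_vec (f s)) (at s)"
    and "s \<in> I" and "\<epsilon> \<in> {1, -1}"
  shows "torsion \<beta> s = schwarzian f s"
    and "frenet_N \<beta> s =
      - (\<epsilon> * (deriv (deriv f) s)\<^sup>2 / (4 * (deriv f s)^3)) *\<^sub>R cone_vec (f s)
      + (\<epsilon> * deriv (deriv f) s / deriv f s) *\<^sub>R tangent_vec (f s)
      - (\<epsilon> * deriv f s) *\<^sub>R axis_vec"
proof -
  define d1 d2 d3 where
    "d1 = deriv f s" and "d2 = deriv (deriv f) s" and "d3 = deriv (deriv (deriv f)) s"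
  have [simp]: "d1 \<noteq> 0"
    using assms(3,5) by (simp add: d1_def)
  have \<epsilon>: "\<epsilon> * \<epsilon> = 1"
    using assms(6) by auto
  note n1 = nderiv_1_cone[OF assms(1-5), folded d1_def]
  note n3 = nderiv_3_cone[OF assms(1-5), folded d3_def d2_def d1_def]
  have "torsion \<beta> s =
      1/2 * ((\<epsilon> * \<epsilon>) * (d2 / d1)\<^sup>2 - 4 * (\<epsilon> * \<epsilon>) * (d2\<^sup>2 / d1^3 - d3 / (2 * d1\<^sup>2)) * d1)"
    unfolding torsion_def n3 minkowski_cone_frame by (simp add: power2_eq_square)
  also have "\<dots> = d3 / d1 - 3 / 2 * (d2 / d1)\<^sup>2"
    unfolding \<epsilon> by (simp add: field_simps power2_eq_square power3_eq_cube)
  finally have \<tau>: "torsion \<beta> s = d3 / d1 - 3 / 2 * (d2 / d1)\<^sup>2" .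
  then show "torsion \<beta> s = schwarzian f s"
    using schwarzian_eq[OF assms(2,5)] assms(3,5) by (simp add: d1_def d2_def d3_def)
  \<comment> \<open>The \<open>cone_vec\<close> coefficient of \<open>- frenet_N\<close>: the terms
    with \<open>d3\<close> cancel, and \<open>1 - 3/4\<close> leaves the factor
    \<open>1/4\<close>.\<close>
  have coeff: "\<epsilon> * (d2\<^sup>2 / d1^3 - d3 / (2 * d1\<^sup>2))
      + (d3 / d1 - 3 / 2 * (d2 / d1)\<^sup>2) * (\<epsilon> / (2 * d1)) = \<epsilon> * d2\<^sup>2 / (4 * d1^3)"
    by (simp add: field_simps power2_eq_square power3_eq_cube)
  have "frenet_N \<beta> s =
      - (\<epsilon> * (d2\<^sup>2 / d1^3 - d3 / (2 * d1\<^sup>2))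
      + (d3 / d1 - 3 / 2 * (d2 / d1)\<^sup>2) * (\<epsilon> / (2 * d1))) *\<^sub>R cone_vec (f s)
      + (\<epsilon> * d2 / d1) *\<^sub>R tangent_vec (f s) - (\<epsilon> * d1) *\<^sub>R axis_vec"
    unfolding frenet_N_def \<tau>[unfolded torsion_def] unfolding n1 n3
    by (simp only: scaleR_left_distrib scaleR_left_diff_distrib scaleR_scaleR scaleR_minus_left)
      simp
  then show "frenet_N \<beta> s =
      - (\<epsilon> * (deriv (deriv f) s)\<^sup>2 / (4 * (deriv f s)^3)) *\<^sub>R cone_vec (f s)
      + (\<epsilon> * deriv (deriv f) s / deriv f s) *\<^sub>R tangent_vec (f s)
      - (\<epsilon> * deriv f s) *\<^sub>R axis_vec"
    unfolding coeff unfolding d1_def d2_def .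
qed

section \<open>From the integral formula to the tangent\<close>

lemma isCont_integrand:
  fixes f :: "real \<Rightarrow> real"
  assumes "smooth_on I f" and "s \<in> I" and "deriv f s \<noteq> 0"
  shows "isCont (\<lambda>t. (1 / deriv f t) *\<^sub>R cone_vec (f t)) s"
proof -
  \<comment> \<open>The integrand is the tangent field with the value \<open>2\<close> in place of
    \<open>\<epsilon>\<close>, so its differentiability is already known.\<close>
  have "(\<lambda>t. (1 / deriv f t) *\<^sub>R cone_vec (f t)) =
      (\<lambda>t. (2 / (2 * deriv f t)) *\<^sub>R cone_vec (f t))"
    by (rule ext) (simp add: field_simps)
  then show ?thesis
    using has_vector_derivative_continuous[OF has_vector_derivative_tangent_field[OF assms, of 2]]
    by (simp only:)
qed

text \<open>Recovers the tangent from any given representation, so that the frame formulas hold for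
  all of them and not just for the one constructed later.\<close>

lemma null_representation_has_vector_derivative:
  assumes "null_representation \<alpha> J \<phi> I \<epsilon> f" and "s \<in> I"
  shows "((\<alpha> \<circ> \<phi>) has_vector_derivative (\<epsilon> / (2 * deriv f s)) *\<^sub>R cone_vec (f s)) (at s)"
proof -
  let ?g = "\<lambda>t. (1 / deriv f t) *\<^sub>R cone_vec (f t)"
  have I: "open_interval I" "open I" and f: "smooth_on I f" "\<forall>s\<in>I. deriv f s \<noteq> 0"
    and rep: "\<And>u. u \<in> I \<Longrightarrow> (\<alpha> \<circ> \<phi>) u = (\<alpha> \<circ> \<phi>) s + (\<epsilon> / 2) *\<^sub>R (LBINT t=s..u. ?g t)"
    using assms unfolding null_representation_def open_interval_def cone_vec_def by blast+
  have cont: "\<forall>t\<in>I. isCont ?g t"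
    using f by (intro ballI isCont_integrand) auto
  obtain G where G: "\<forall>t\<in>I. (G has_vector_derivative ?g t) (at t)"
    using open_interval_antiderivative[OF I(1) cont] by blast
  \<comment> \<open>With base point \<open>s\<close>, the integral up to \<open>u\<close> equals
    \<open>G u - G s\<close>; the curve thus agrees on \<open>I\<close> with a function whose
    derivative is known.\<close>
  have "((\<lambda>u. (\<alpha> \<circ> \<phi>) s + (\<epsilon> / 2) *\<^sub>R (G u - G s)) has_vector_derivative
      0 + (\<epsilon> / 2) *\<^sub>R (?g s - 0)) (at s)"
    by (intro has_vector_derivative_add has_vector_derivative_diff has_vector_derivative_const
        bounded_linear.has_vector_derivative[OF bounded_linear_scaleR_right] bspec[OF G assms(2)])
  moreover have "(\<alpha> \<circ> \<phi>) s + (\<epsilon> / 2) *\<^sub>R (G u - G s) = (\<alpha> \<circ> \<phi>) u" if "u \<in> I" for u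
    using rep[OF that] LBINT_eq_diff[OF I(1) assms(2) that cont G] by simp
  ultimately have "((\<alpha> \<circ> \<phi>) has_vector_derivative 0 + (\<epsilon> / 2) *\<^sub>R (?g s - 0)) (at s)"
    using has_vector_derivative_transform_within_open[OF _ I(2) assms(2)] by blast
  then show ?thesis
    by simp
qed

section \<open>The representation of null curves\<close>

text \<open>\<open>F\<close> depends on the direction of the tangent only, so \<open>F' = 0\<close> would make \<open>\<alpha>''\<close> a multiple
  of \<open>\<alpha>'\<close>.\<close>

lemma null_curve_tangent:
  assumes "open J" and null: "null_curve \<alpha> J" and nd: "nondegenerate \<alpha> J"
    and x: "\<forall>t\<in>J. deriv (\<lambda>u. \<alpha> u $ 1) t \<noteq> 0"
  obtains h F where "smooth_on J h" and "smooth_on J F"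
    and "\<forall>t\<in>J. (\<alpha> has_vector_derivative h t *\<^sub>R cone_vec (F t)) (at t)"
    and "\<forall>t\<in>J. F t \<noteq> 0 \<and> h t \<noteq> 0 \<and> deriv F t \<noteq> 0"
proof -
  define a where "a t = vector_derivative \<alpha> (at t)" for t
  define h where "h t = (a t $ 3 - a t $ 2) / 2" for t
  define F where "F t = a t $ 1 / (a t $ 3 - a t $ 2)" for t
  have \<alpha>: "smooth_on J \<alpha>"
    using null by (simp add: null_curve_def)
  have a: "smooth_on J a" "\<forall>t\<in>J. (\<alpha> has_vector_derivative a t) (at t)"
    using smooth_on_vector_derivative[OF \<alpha>] smooth_on_has_vector_derivative[OF \<alpha>]
    by (simp_all add: a_def[abs_def])
  have nderiv_a: "nderiv (Suc 0) \<alpha> = a"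
    by (simp add: nderiv_Suc a_def[abs_def])
  have a1: "a t $ 1 \<noteq> 0" if "t \<in> J" for t
  proof -
    have "((\<lambda>u. \<alpha> u $ 1) has_real_derivative a t $ 1) (at t)"
      using bounded_linear.has_vector_derivative[OF bounded_linear_vec_nth bspec[OF a(2) that]]
      by (simp add: has_real_derivative_iff_has_vector_derivative)
    then show ?thesis
      using x that by (metis DERIV_imp_deriv)
  qed
  have iso: "minkowski (a t) (a t) = 0" if "t \<in> J" for t
    using null that unfolding null_curve_def One_nat_def nderiv_a by blast
  \<comment> \<open>Equality of these components would reduce isotropy to the vanishing of the
    square of the first one.\<close>
  have k: "a t $ 3 \<noteq> a t $ 2" if "t \<in> J" for t
    using iso[OF that] a1[OF that] by (auto simp: minkowski_def)
  have F0: "F t \<noteq> 0" "h t \<noteq> 0" if "t \<in> J" for t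
    using a1[OF that] k[OF that] by (simp_all add: F_def h_def)
  have tangent: "a t = h t *\<^sub>R cone_vec (F t)" if "t \<in> J" for t
    unfolding h_def F_def by (rule isotropic_eq_cone_vec[OF iso[OF that] k[OF that]])
  have L: "bounded_linear (\<lambda>v::real^3. v $ 3 - v $ 2)"
    by (intro bounded_linear_sub bounded_linear_vec_nth)
  have h: "smooth_on J h"
    using smooth_on_mult[OF \<open>open J\<close> smooth_on_bounded_linear[OF \<open>open J\<close> L a(1)]
        smooth_on_const[OF \<open>open J\<close>, of "1/2"]]
    by (simp add: h_def[abs_def])
  have F: "smooth_on J F"
    unfolding F_def[abs_def] divide_inverse
  proof (rule smooth_on_mult[OF \<open>open J\<close> _ smooth_on_inverse[OF \<open>open J\<close>]])
    show "smooth_on J (\<lambda>t. a t $ 1)"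
      using \<open>open J\<close> bounded_linear_vec_nth a(1) by (rule smooth_on_bounded_linear)
    show "smooth_on J (\<lambda>t. a t $ 3 - a t $ 2)"
      using \<open>open J\<close> L a(1) by (rule smooth_on_bounded_linear)
    show "\<forall>t\<in>J. a t $ 3 - a t $ 2 \<noteq> 0"
      using k by simp
  qed
  have F': "deriv F t \<noteq> 0" if "t \<in> J" for t
  proof
    assume 0: "deriv F t = 0"
    have "((\<lambda>t. h t *\<^sub>R cone_vec (F t)) has_vector_derivative
        h t *\<^sub>R (2 * 0) *\<^sub>R tangent_vec (F t) + deriv h t *\<^sub>R cone_vec (F t)) (at t)"
      using has_vector_derivative_scaleR[OF smooth_on_DERIV[OF h that]
          has_vector_derivative_cone_vec[OF smooth_on_DERIV[OF F that]]]
      by (simp add: 0)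
    then have "(a has_vector_derivative deriv h t *\<^sub>R cone_vec (F t)) (at t)"
      using has_vector_derivative_transform_within_open[OF _ \<open>open J\<close> that tangent[symmetric]]
      by simp
    then have "nderiv 2 \<alpha> t = deriv h t *\<^sub>R cone_vec (F t)"
      by (simp add: numeral_2_eq_2 nderiv_Suc[of "Suc 0"] nderiv_a vector_derivative_at)
    also have "\<dots> = (deriv h t / h t) *\<^sub>R nderiv 1 \<alpha> t"
      using F0[OF that] by (simp add: nderiv_a tangent[OF that])
    finally have "nderiv 2 \<alpha> t \<in> span {nderiv 1 \<alpha> t, nderiv 3 \<alpha> t}"
      by (simp add: span_base span_scale)
    \<comment> \<open>Distinctness ensures that removing the second derivative keeps the other
      two.\<close>
    moreover have "{nderiv 1 \<alpha> t, nderiv 2 \<alpha> t, nderiv 3 \<alpha> t} - {nderiv 2 \<alpha> t} =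
        {nderiv 1 \<alpha> t, nderiv 3 \<alpha> t}"
      using nd that by (auto simp: nondegenerate_def)
    ultimately have "dependent {nderiv 1 \<alpha> t, nderiv 2 \<alpha> t, nderiv 3 \<alpha> t}"
      unfolding dependent_def by auto
    then show False
      using nd that by (simp add: nondegenerate_def)
  qed
  show ?thesis
    using h F a(2) tangent F0 F' by (intro that[of h F]) auto
qed

section \<open>Construction of the pseudo-arc parametrization\<close>

lemma null_representation_exists:
  assumes J: "open_interval J" and "null_curve \<alpha> J" and "nondegenerate \<alpha> J"
    and "\<forall>t\<in>J. deriv (\<lambda>u. \<alpha> u $ 1) t \<noteq> 0"
  shows "\<exists>\<phi> I \<epsilon> f. null_representation \<alpha> J \<phi> I \<epsilon> f"
proof -
  have "open J"
    using J by (simp add: open_interval_def)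
  obtain h F where h: "smooth_on J h" and F: "smooth_on J F"
    and \<alpha>': "\<forall>t\<in>J. (\<alpha> has_vector_derivative h t *\<^sub>R cone_vec (F t)) (at t)"
    and nz: "\<forall>t\<in>J. F t \<noteq> 0 \<and> h t \<noteq> 0 \<and> deriv F t \<noteq> 0"
    using \<open>open J\<close> assms(2-4) by (rule null_curve_tangent)
  \<comment> \<open>\<open>q\<close> is the \<open>tangent_vec\<close> coefficient of the second
    derivative of \<open>\<alpha>\<close>. A change of parameter with \<open>ds/dt = p\<close>
    divides it by the square of \<open>p\<close>, so the new coefficient is
    \<open>\<epsilon>\<close> when that square is \<open>\<epsilon> * q t\<close>.\<close>
  define q where "q t = 2 * (h t * deriv F t)" for t
  have q: "smooth_on J q"
    unfolding q_def[abs_def] using \<open>open J\<close> h F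
    by (intro smooth_on_mult smooth_on_const smooth_on_deriv)
  have "\<forall>t\<in>J. isCont q t" "\<forall>t\<in>J. q t \<noteq> 0"
    using smooth_on_isCont[OF q] nz by (auto simp: q_def)
  then obtain \<epsilon> :: real where \<epsilon>: "\<epsilon> \<in> {1, -1}" and pos: "\<forall>t\<in>J. \<epsilon> * q t > 0"
    by (rule nonzero_constant_sign[OF J])
  have \<epsilon>2: "\<epsilon> * \<epsilon> = 1"
    using \<epsilon> by auto
  define p where "p t = sqrt (\<epsilon> * q t)" for t
  have p: "smooth_on J p" "\<forall>t\<in>J. p t > 0"
    unfolding p_def[abs_def] using \<open>open J\<close> q pos
    by (auto intro!: smooth_on_sqrt smooth_on_mult smooth_on_const)
  obtain \<phi> I where I: "open_interval I" and \<phi>: "reparametrization \<phi> I J"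
    and \<phi>': "\<forall>s\<in>I. (\<phi> has_vector_derivative inverse (p (\<phi> s))) (at s)"
    using J p by (rule inverse_antiderivative)
  have "open I"
    using I by (simp add: open_interval_def)
  have img: "\<phi> s \<in> J" if "s \<in> I" for s
    using \<phi> that unfolding reparametrization_def by (meson bij_betw_apply)
  define f where "f s = F (\<phi> s)" for s
  have f: "smooth_on I f"
    unfolding f_def[abs_def]
  proof (rule smooth_on_compose[OF \<open>open I\<close> _ F])
    show "\<phi> ` I \<subseteq> J"
      using img by blast
    show "smooth_on I \<phi>"
      using \<phi> unfolding reparametrization_def by blast
  qed
  have f': "deriv f s = deriv F (\<phi> s) / p (\<phi> s)" if "s \<in> I" for s
  proof -
    have "(F has_real_derivative deriv F (\<phi> s)) (at (\<phi> s))"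
      using F img[OF that] by (rule smooth_on_DERIV)
    moreover have "(\<phi> has_real_derivative inverse (p (\<phi> s))) (at s)"
      using \<phi>' that by (simp add: has_real_derivative_iff_has_vector_derivative)
    ultimately have "(f has_real_derivative deriv F (\<phi> s) * inverse (p (\<phi> s))) (at s)"
      unfolding f_def[abs_def] by (rule DERIV_chain2)
    then show ?thesis
      by (simp add: DERIV_imp_deriv divide_inverse)
  qed
  have f_nz: "f s \<noteq> 0" "deriv f s \<noteq> 0" if "s \<in> I" for s
    using nz p(2) img[OF that] f'[OF that] by (auto simp: f_def less_le)
  have \<beta>': "((\<alpha> \<circ> \<phi>) has_vector_derivative (\<epsilon> / (2 * deriv f s)) *\<^sub>R cone_vec (f s)) (at s)"
    if "s \<in> I" for s
  proof -
    let ?t = "\<phi> s"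
    have t: "p ?t > 0" "deriv F ?t \<noteq> 0" "\<epsilon> * q ?t > 0"
      using img[OF that] p(2) nz pos by auto
    have "p ?t * p ?t = \<epsilon> * q ?t"
      using t(3) by (simp add: p_def)
    \<comment> \<open>Multiplying by \<open>\<epsilon>\<close> moves the sign to the left; division
      then turns \<open>h\<close> into the required coefficient.\<close>
    then have "\<epsilon> * (p ?t * p ?t) = 2 * (h ?t * deriv F ?t)"
      using \<epsilon>2 by (simp add: q_def flip: mult.assoc)
    then have "inverse (p ?t) * h ?t = \<epsilon> / (2 * deriv f s)"
      using t(1,2) by (simp add: f'[OF that] field_simps)
    then show ?thesis
      using vector_diff_chain_at[OF bspec[OF \<phi>' that] bspec[OF \<alpha>' img[OF that]]]
      by (simp add: f_def)
  qed
  have "pseudo_arc_parametrized (\<alpha> \<circ> \<phi>) I"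
    unfolding pseudo_arc_parametrized_def
  proof
    fix s
    assume "s \<in> I"
    with nderiv_2_cone[OF \<open>open I\<close> f _ _ this, of "\<alpha> \<circ> \<phi>" \<epsilon>] f_nz(2) \<beta>'
    \<comment> \<open>The zero \<open>axis_vec\<close> term brings the vector into the shape of
      \<open>minkowski_cone_frame\<close>, with \<open>b = \<epsilon>\<close> and
      \<open>c = 0\<close>.\<close>
    have "nderiv 2 (\<alpha> \<circ> \<phi>) s =
        - (\<epsilon> * deriv (deriv f) s / (2 * (deriv f s)\<^sup>2)) *\<^sub>R cone_vec (f s)
        + \<epsilon> *\<^sub>R tangent_vec (f s) + 0 *\<^sub>R axis_vec"
      by simp
    then show "minkowski (nderiv 2 (\<alpha> \<circ> \<phi>) s) (nderiv 2 (\<alpha> \<circ> \<phi>) s) = 1"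
      using \<epsilon>2 by (simp only: minkowski_cone_frame) (simp add: power2_eq_square)
  qed
  moreover have "(\<alpha> \<circ> \<phi>) s = (\<alpha> \<circ> \<phi>) s0 +
      (\<epsilon> / 2) *\<^sub>R (LBINT t=s0..s. (1 / deriv f t) *\<^sub>R cone_vec (f t))"
    if "s \<in> I" "s0 \<in> I" for s s0
  proof -
    \<comment> \<open>Since \<open>\<epsilon> * \<epsilon> = 1\<close>, scaling the curve by
      \<open>2 * \<epsilon>\<close> undoes the factor \<open>\<epsilon> / 2\<close> and gives an
      antiderivative of the integrand.\<close>
    have "((\<lambda>u. (2 * \<epsilon>) *\<^sub>R (\<alpha> \<circ> \<phi>) u) has_vector_derivative
        (1 / deriv f t) *\<^sub>R cone_vec (f t)) (at t)" if "t \<in> I" for t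
      using bounded_linear.has_vector_derivative[OF bounded_linear_scaleR_right[of "2 * \<epsilon>"] \<beta>'[OF that]]
        \<epsilon>2
      by simp
    moreover have "isCont (\<lambda>t. (1 / deriv f t) *\<^sub>R cone_vec (f t)) t" if "t \<in> I" for t
      using f that f_nz(2)[OF that] by (rule isCont_integrand)
    ultimately have "(LBINT t=s0..s. (1 / deriv f t) *\<^sub>R cone_vec (f t)) =
        (2 * \<epsilon>) *\<^sub>R (\<alpha> \<circ> \<phi>) s - (2 * \<epsilon>) *\<^sub>R (\<alpha> \<circ> \<phi>) s0"
      using I that by (intro LBINT_eq_diff[of I]) auto
    then show ?thesis
      using \<epsilon>2 by (simp add: scaleR_diff_right)
  qed
  ultimately have "null_representation \<alpha> J \<phi> I \<epsilon> f"
    unfolding null_representation_def cone_vec_def[symmetric]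
    using I \<phi> \<epsilon> f f_nz by blast
  then show ?thesis
    by blast
qed

section \<open>Frame formulas for an arbitrary representation\<close>

lemma null_representation_frenet:
  assumes rep: "null_representation \<alpha> J \<phi> I \<epsilon> f" and s: "s \<in> I"
  shows "torsion (\<alpha> \<circ> \<phi>) s = schwarzian f s"
    and "frenet_L (\<alpha> \<circ> \<phi>) s =
        (\<epsilon> / (2 * deriv f s)) *\<^sub>R vector [2 * f s, (f s)\<^sup>2 - 1, (f s)\<^sup>2 + 1]"
    and "frenet_W (\<alpha> \<circ> \<phi>) s =
        - (\<epsilon> * deriv (deriv f) s / (2 * (deriv f s)\<^sup>2)) *\<^sub>R
            vector [2 * f s, (f s)\<^sup>2 - 1, (f s)\<^sup>2 + 1]
        + \<epsilon> *\<^sub>R vector [1, f s, f s]"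
    and "frenet_N (\<alpha> \<circ> \<phi>) s =
        - (\<epsilon> * (deriv (deriv f) s)\<^sup>2 / (4 * (deriv f s)^3)) *\<^sub>R
            vector [2 * f s, (f s)\<^sup>2 - 1, (f s)\<^sup>2 + 1]
        + (\<epsilon> * deriv (deriv f) s / deriv f s) *\<^sub>R vector [1, f s, f s]
        - (\<epsilon> * deriv f s) *\<^sub>R vector [0, 1, 1]"
proof -
  have f: "open I" "smooth_on I f" "\<forall>s\<in>I. deriv f s \<noteq> 0" and \<epsilon>: "\<epsilon> \<in> {1, -1}"
    using rep unfolding null_representation_def open_interval_def by blast+
  have \<beta>': "\<forall>s\<in>I. ((\<alpha> \<circ> \<phi>) has_vector_derivative
      (\<epsilon> / (2 * deriv f s)) *\<^sub>R cone_vec (f s)) (at s)"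
    using null_representation_has_vector_derivative[OF rep] by blast
  note frame = nderiv_1_cone[OF f \<beta>' s] nderiv_2_cone[OF f \<beta>' s]
    frenet_frame_cone[OF f \<beta>' s \<epsilon>]
  show "torsion (\<alpha> \<circ> \<phi>) s = schwarzian f s"
    "frenet_L (\<alpha> \<circ> \<phi>) s =
        (\<epsilon> / (2 * deriv f s)) *\<^sub>R vector [2 * f s, (f s)\<^sup>2 - 1, (f s)\<^sup>2 + 1]"
    "frenet_W (\<alpha> \<circ> \<phi>) s =
        - (\<epsilon> * deriv (deriv f) s / (2 * (deriv f s)\<^sup>2)) *\<^sub>R
            vector [2 * f s, (f s)\<^sup>2 - 1, (f s)\<^sup>2 + 1]
        + \<epsilon> *\<^sub>R vector [1, f s, f s]"
    "frenet_N (\<alpha> \<circ> \<phi>) s =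
        - (\<epsilon> * (deriv (deriv f) s)\<^sup>2 / (4 * (deriv f s)^3)) *\<^sub>R
            vector [2 * f s, (f s)\<^sup>2 - 1, (f s)\<^sup>2 + 1]
        + (\<epsilon> * deriv (deriv f) s / deriv f s) *\<^sub>R vector [1, f s, f s]
        - (\<epsilon> * deriv f s) *\<^sub>R vector [0, 1, 1]"
    unfolding frenet_L_def frenet_W_def
    using frame unfolding cone_vec_def tangent_vec_def axis_vec_def by blast+
qed

theorem theorem1:
  fixes \<alpha> :: "real \<Rightarrow> real^3" and J :: "real set"
  assumes "open_interval J"
    and "null_curve \<alpha> J"
    and "nondegenerate \<alpha> J"
    and "\<forall>t\<in>J. \<forall>i. deriv (\<lambda>u. \<alpha> u $ i) t \<noteq> 0"
  shows "(\<exists>\<phi> I \<epsilon> f. null_representation \<alpha> J \<phi> I \<epsilon> f) \<and>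
    (\<forall>\<phi> I \<epsilon> f. null_representation \<alpha> J \<phi> I \<epsilon> f \<longrightarrow>
      (\<forall>s\<in>I.
        torsion (\<alpha> \<circ> \<phi>) s = schwarzian f s \<and>
        frenet_L (\<alpha> \<circ> \<phi>) s =
          (\<epsilon> / (2 * deriv f s)) *\<^sub>R vector [2 * f s, (f s)\<^sup>2 - 1, (f s)\<^sup>2 + 1] \<and>
        frenet_W (\<alpha> \<circ> \<phi>) s =
          - (\<epsilon> * deriv (deriv f) s / (2 * (deriv f s)\<^sup>2)) *\<^sub>R
              vector [2 * f s, (f s)\<^sup>2 - 1, (f s)\<^sup>2 + 1]
          + \<epsilon> *\<^sub>R vector [1, f s, f s] \<and>
        frenet_N (\<alpha> \<circ> \<phi>) s =
          - (\<epsilon> * (deriv (deriv f) s)\<^sup>2 / (4 * (deriv f s)^3)) *\<^sub>R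
              vector [2 * f s, (f s)\<^sup>2 - 1, (f s)\<^sup>2 + 1]
          + (\<epsilon> * deriv (deriv f) s / deriv f s) *\<^sub>R vector [1, f s, f s]
          - (\<epsilon> * deriv f s) *\<^sub>R vector [0, 1, 1]))"
proof -
  have "\<exists>\<phi> I \<epsilon> f. null_representation \<alpha> J \<phi> I \<epsilon> f"
    by (rule null_representation_exists[OF assms(1-3)]) (use assms(4) in blast)
  then show ?thesis
    by (intro conjI allI impI ballI) (assumption | erule (1) null_representation_frenet)+
qed

end
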